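(* Let $\Sigma=(\mathsf{P}_\Sigma,\mathsf{R}_\Sigma,\rho^\Sigma)$ be a PR-structure. Then $\Sigma$ is preorderal if and only if the following two conditions are satisfied: (1) there exists $\mathbf{i}\in \mathsf{R}_\Sigma$ such that $\mathbf{i}\in \rho^\Sigma(a,a)$ for every $a\in \mathsf{P}_\Sigma$; (2) for every $r,s\in \mathsf{R}_\Sigma$ there exists (in general not unique) $s\Box r\in \mathsf{R}_\Sigma$ such that for every $a,b,c\in \mathsf{P}_\Sigma$, $s\Box r\in \rho^\Sigma(a,c)$ whenever $r\in \rho^\Sigma(a,b)$ and $s\in \rho^\Sigma(b,c)$.
   Context: A PR-structure is a triple $\Sigma=(\mathsf{P}_\Sigma,\mathsf{R}_\Sigma,\rho^\Sigma)$ where $\mathsf{P}_\Sigma$ and $\mathsf{R}_\Sigma$ are non-empty sets and $\rho^\Sigma:\mathsf{P}_\Sigma\times\mathsf{P}_\Sigma\to\mathcal{P}(\mathsf{R}_\Sigma)$ is a function. For a set $I$ and functions $\varphi,\psi:I\to\mathsf{P}_\Sigma$, write $\varphi\vdash^\Sigma_I\psi$ iff $\bigcap_{i\in I}\rho^\Sigma(\varphi(i),\psi(i))\neq\emptyset$, i.e. iff there is $r\in\mathsf{R}_\Sigma$ with $r\in\rho^\Sigma(\varphi(i),\psi(i))$ for every $i\in I$. $\Sigma$ is called preorderal if for every set $I$ the relation $\vdash^\Sigma_I$ on $\mathsf{P}_\Sigma^I$ is a preorder (reflexive and transitive). *)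

theory Defs
  imports "HOL-Library.FuncSet"
begin

record ('p, 'r) pr_triple =
  carrier_P :: "'p set"
  carrier_R :: "'r set"
  rho :: "'p \<Rightarrow> 'p \<Rightarrow> 'r set"

definition PR_structure :: "('p, 'r) pr_triple \<Rightarrow> bool" where
  "PR_structure \<Sigma> \<longleftrightarrow>
     carrier_P \<Sigma> \<noteq> {} \<and> carrier_R \<Sigma> \<noteq> {} \<and>
     (\<forall>a\<in>carrier_P \<Sigma>. \<forall>b\<in>carrier_P \<Sigma>. rho \<Sigma> a b \<subseteq> carrier_R \<Sigma>)"

text \<open>
  The intersection over \<open>i \<in> I\<close> is taken inside the R-carrier, so for empty \<open>I\<close> it
  is the whole R-carrier.
\<close>

definition entails ::
  "('p, 'r) pr_triple \<Rightarrow> 'i set \<Rightarrow> ('i \<Rightarrow> 'p) \<Rightarrow> ('i \<Rightarrow> 'p) \<Rightarrow> bool" where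
  "entails \<Sigma> I \<phi> \<psi> \<longleftrightarrow>
     {r \<in> carrier_R \<Sigma>. \<forall>i\<in>I. r \<in> rho \<Sigma> (\<phi> i) (\<psi> i)} \<noteq> {}"

definition entails_rel ::
  "('p, 'r) pr_triple \<Rightarrow> 'i set \<Rightarrow> (('i \<Rightarrow> 'p) \<times> ('i \<Rightarrow> 'p)) set" where
  "entails_rel \<Sigma> I =
     {(\<phi>, \<psi>). \<phi> \<in> I \<rightarrow>\<^sub>E carrier_P \<Sigma> \<and> \<psi> \<in> I \<rightarrow>\<^sub>E carrier_P \<Sigma> \<and> entails \<Sigma> I \<phi> \<psi>}"

text \<open>
  HOL cannot quantify over types inside a formula, so the quantification over every set \<open>I\<close>
  is relative to a type of indices, given as the first argument, and \<open>I\<close> ranges over all its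
  subsets. The notion is the intended one only if that type is not too small: over a one-element
  type, for instance, it concerns only index sets with at most one element. An index type that is
  the disjoint sum of an arbitrary type and \<open>'p \<times> 'p \<times> 'p\<close> is large enough: the relations
  depend on \<open>\<phi>\<close> and \<open>\<psi>\<close> only through the points they take, and transitivity involves three
  such functions at a time.
\<close>

definition preorderal :: "'i itself \<Rightarrow> ('p, 'r) pr_triple \<Rightarrow> bool" where
  "preorderal U \<Sigma> \<longleftrightarrow>
     (\<forall>I :: 'i set. preorder_on (I \<rightarrow>\<^sub>E carrier_P \<Sigma>) (entails_rel \<Sigma> I))"

end

theory Submission
  imports Defs
begin

text \<open>
  Reflexivity at an enumeration of all of \<open>P\<close> yields \<open>e\<close>. Given \<open>r\<close> and \<open>s\<close>, take as index set
  all triples \<open>(a, b, c)\<close> with \<open>r \<in> \<rho>(a, b)\<close> and \<open>s \<in> \<rho>(b, c)\<close>: the first projection entails the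
  second through \<open>r\<close>, the second entails the third through \<open>s\<close>, and a witness of transitivity is
  a composite of \<open>r\<close> and \<open>s\<close>. Conversely, \<open>e\<close> and the composites are uniform witnesses.
\<close>

text \<open>Index sets have to be subsets of \<open>'i\<close>, while the families needed below are
  naturally indexed by points or triples of points. An injection \<open>f\<close> carries such an
  index set \<open>K\<close> into \<open>'i\<close>; \<open>inv f\<close> recovers the original
  index, and \<open>restrict\<close> makes the families extensional, as membership in the function
  space demands.\<close>

lemma reindexed_in_entails_rel_iff:
  assumes "inj f" "u \<in> K \<rightarrow> carrier_P \<Sigma>" "v \<in> K \<rightarrow> carrier_P \<Sigma>"
  shows "(restrict (u \<circ> inv f) (f ` K), restrict (v \<circ> inv f) (f ` K)) \<in> entails_rel \<Sigma> (f ` K) \<longleftrightarrow>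
    (\<exists>t\<in>carrier_R \<Sigma>. \<forall>k\<in>K. t \<in> rho \<Sigma> (u k) (v k))"
proof -
  have "restrict (w \<circ> inv f) (f ` K) \<in> f ` K \<rightarrow>\<^sub>E carrier_P \<Sigma>" if "w \<in> K \<rightarrow> carrier_P \<Sigma>" for w
    using assms(1) that by (auto simp: Pi_iff)
  then show ?thesis
    using assms by (auto simp: entails_rel_def entails_def)
qed

lemma preorderal_imp_identity:
  fixes f :: "'p \<times> 'p \<times> 'p \<Rightarrow> 'i" and \<Sigma> :: "('p, 'r) pr_triple"
  assumes "preorderal TYPE('i) \<Sigma>" "inj f"
  shows "\<exists>e\<in>carrier_R \<Sigma>. \<forall>a\<in>carrier_P \<Sigma>. e \<in> rho \<Sigma> a a"
proof -
  \<comment> \<open>The diagonal is a copy of the points inside the domain of \<open>f\<close>, so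
    the injection used for composites serves here too; \<open>fst\<close> reads the point
    back.\<close>
  let ?K = "(\<lambda>a. (a, a, a)) ` carrier_P \<Sigma>"
  let ?\<phi> = "restrict (fst \<circ> inv f) (f ` ?K)"
  have "?\<phi> \<in> f ` ?K \<rightarrow>\<^sub>E carrier_P \<Sigma>"
    using assms(2) by auto
  then have "(?\<phi>, ?\<phi>) \<in> entails_rel \<Sigma> (f ` ?K)"
    using assms(1) unfolding preorderal_def preorder_on_def by (blast dest: refl_onD)
  then show ?thesis
    by (subst (asm) reindexed_in_entails_rel_iff[OF assms(2)]) auto
qed

lemma preorderal_imp_composite:
  fixes f :: "'p \<times> 'p \<times> 'p \<Rightarrow> 'i" and \<Sigma> :: "('p, 'r) pr_triple"
  assumes "preorderal TYPE('i) \<Sigma>" "inj f" "r \<in> carrier_R \<Sigma>" "s \<in> carrier_R \<Sigma>"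
  shows "\<exists>t\<in>carrier_R \<Sigma>. \<forall>a\<in>carrier_P \<Sigma>. \<forall>b\<in>carrier_P \<Sigma>. \<forall>c\<in>carrier_P \<Sigma>.
    r \<in> rho \<Sigma> a b \<and> s \<in> rho \<Sigma> b c \<longrightarrow> t \<in> rho \<Sigma> a c"
proof -
  let ?P = "carrier_P \<Sigma>"
  let ?K = "{(a, b, c) \<in> ?P \<times> ?P \<times> ?P. r \<in> rho \<Sigma> a b \<and> s \<in> rho \<Sigma> b c}"
  let ?fam = "\<lambda>u. restrict (u \<circ> inv f) (f ` ?K)"
  let ?mid = "\<lambda>k. fst (snd k)" and ?last = "\<lambda>k. snd (snd k)"
  have into: "fst \<in> ?K \<rightarrow> ?P" "?mid \<in> ?K \<rightarrow> ?P" "?last \<in> ?K \<rightarrow> ?P"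
    by auto
  note iff = reindexed_in_entails_rel_iff[OF assms(2)]
  have "(?fam fst, ?fam ?mid) \<in> entails_rel \<Sigma> (f ` ?K)"
    unfolding iff[OF into(1,2)] using assms(3) by auto
  moreover have "(?fam ?mid, ?fam ?last) \<in> entails_rel \<Sigma> (f ` ?K)"
    unfolding iff[OF into(2,3)] using assms(4) by auto
  ultimately have "(?fam fst, ?fam ?last) \<in> entails_rel \<Sigma> (f ` ?K)"
    using assms(1) unfolding preorderal_def preorder_on_def by (blast dest: transD)
  \<comment> \<open>The middle point \<open>b\<close> drops out of the conclusion but is still part
    of the index, so a single \<open>t\<close> works for all \<open>b\<close> at once.\<close>
  then show ?thesis
    unfolding iff[OF into(1,3)] by fastforce
qed

text \<open>Since the witnesses are chosen independently of the index set, the argument works over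
  every type \<open>'i\<close>, whatever its size.\<close>

lemma preorderalI:
  fixes \<Sigma> :: "('p, 'r) pr_triple"
  assumes e: "e \<in> carrier_R \<Sigma>" "\<And>a. a \<in> carrier_P \<Sigma> \<Longrightarrow> e \<in> rho \<Sigma> a a"
    and comp: "\<And>r s. r \<in> carrier_R \<Sigma> \<Longrightarrow> s \<in> carrier_R \<Sigma> \<Longrightarrow>
      \<exists>t\<in>carrier_R \<Sigma>. \<forall>a\<in>carrier_P \<Sigma>. \<forall>b\<in>carrier_P \<Sigma>. \<forall>c\<in>carrier_P \<Sigma>.
        r \<in> rho \<Sigma> a b \<and> s \<in> rho \<Sigma> b c \<longrightarrow> t \<in> rho \<Sigma> a c"
  shows "preorderal TYPE('i) \<Sigma>"
  unfolding preorderal_def preorder_on_def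
proof (intro allI conjI)
  fix I :: "'i set"
  show "entails_rel \<Sigma> I \<subseteq> (I \<rightarrow>\<^sub>E carrier_P \<Sigma>) \<times> (I \<rightarrow>\<^sub>E carrier_P \<Sigma>)"
    by (auto simp: entails_rel_def)
  show "refl_on (I \<rightarrow>\<^sub>E carrier_P \<Sigma>) (entails_rel \<Sigma> I)"
    using e by (auto simp: refl_on_def entails_rel_def entails_def dest: PiE_mem)
  show "trans (entails_rel \<Sigma> I)"
  proof (rule transI)
    fix \<phi> \<psi> \<chi>
    assume "(\<phi>, \<psi>) \<in> entails_rel \<Sigma> I" "(\<psi>, \<chi>) \<in> entails_rel \<Sigma> I"
    then obtain r s where
      fam: "\<phi> \<in> I \<rightarrow>\<^sub>E carrier_P \<Sigma>" "\<psi> \<in> I \<rightarrow>\<^sub>E carrier_P \<Sigma>" "\<chi> \<in> I \<rightarrow>\<^sub>E carrier_P \<Sigma>"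
      and r: "r \<in> carrier_R \<Sigma>" "\<And>i. i \<in> I \<Longrightarrow> r \<in> rho \<Sigma> (\<phi> i) (\<psi> i)"
      and s: "s \<in> carrier_R \<Sigma>" "\<And>i. i \<in> I \<Longrightarrow> s \<in> rho \<Sigma> (\<psi> i) (\<chi> i)"
      unfolding entails_rel_def entails_def by auto
    obtain t where "t \<in> carrier_R \<Sigma>" "\<forall>a\<in>carrier_P \<Sigma>. \<forall>b\<in>carrier_P \<Sigma>. \<forall>c\<in>carrier_P \<Sigma>.
        r \<in> rho \<Sigma> a b \<and> s \<in> rho \<Sigma> b c \<longrightarrow> t \<in> rho \<Sigma> a c"
      using comp[OF r(1) s(1)] by blast
    \<comment> \<open>The composition property of \<open>t\<close> speaks only of points of the
      carrier; \<open>PiE_mem\<close> puts the values of the three families there.\<close>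
    then have "t \<in> carrier_R \<Sigma>" "\<forall>i\<in>I. t \<in> rho \<Sigma> (\<phi> i) (\<chi> i)"
      using r(2) s(2) fam[THEN PiE_mem] by blast+
    then show "(\<phi>, \<chi>) \<in> entails_rel \<Sigma> I"
      using fam unfolding entails_rel_def entails_def by auto
  qed
qed

theorem theorem2p19:
  fixes \<Sigma> :: "('p, 'r) pr_triple"
  assumes "PR_structure \<Sigma>"
  shows "preorderal TYPE('i + 'p \<times> 'p \<times> 'p) \<Sigma> \<longleftrightarrow>
    (\<exists>e\<in>carrier_R \<Sigma>. \<forall>a\<in>carrier_P \<Sigma>. e \<in> rho \<Sigma> a a) \<and>
    (\<forall>r\<in>carrier_R \<Sigma>. \<forall>s\<in>carrier_R \<Sigma>. \<exists>t\<in>carrier_R \<Sigma>.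
       \<forall>a\<in>carrier_P \<Sigma>. \<forall>b\<in>carrier_P \<Sigma>. \<forall>c\<in>carrier_P \<Sigma>.
         r \<in> rho \<Sigma> a b \<and> s \<in> rho \<Sigma> b c \<longrightarrow> t \<in> rho \<Sigma> a c)"
    (is "?L \<longleftrightarrow> ?R")
proof
  assume ?L
  \<comment> \<open>The right summand of the index type is there to receive the triples, so
    \<open>Inr\<close> is the injection that both lemmas ask for.\<close>
  have "inj (Inr :: 'p \<times> 'p \<times> 'p \<Rightarrow> 'i + 'p \<times> 'p \<times> 'p)"
    by simp
  with \<open>?L\<close> show ?R
    by (intro conjI ballI preorderal_imp_identity preorderal_imp_composite)
next
  assume ?R
  then show ?L
    by (elim conjE bexE) (rule preorderalI; blast)
qed

end
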